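(* Let $\mathbf{S}$ and $\mathbf{T}$ be two ordered set partitions of $[n]$. Then the alcoved simplices $\Delta_{\mathbf{S}}$ and $\Delta_{\mathbf{T}}$ are compatible (i.e. $\Delta_{\mathbf{S}}+\Delta_{\mathbf{T}}$ is alcoved) if and only if for every subset $I\subset[n]$ with $|I|\le 6$ the alcoved simplices $\Delta_{\mathbf{S}|_I}$ and $\Delta_{\mathbf{T}|_I}$ in $\mathcal{H}_I=\{x\in\mathbb{R}^I:\sum_{i\in I}x_i=0\}$ are compatible.
   Context: $\mathcal{H}_n=\{x\in\mathbb{R}^n:x_1+\dots+x_n=0\}$ (and analogously $\mathcal{H}_I$ for a finite index set $I$). A polytope in $\mathcal{H}_n$ is alcoved if it can be defined inside $\mathcal{H}_n$ by inequalities of the form $x_i-x_j\le a_{i,j}$ ($i\ne j$), equivalently all of its facet normal directions are parallel to roots $e_i-e_j$; two alcoved polytopes are compatible if their Minkowski sum is alcoved. An ordered set partition of $[n]$ is a tuple $\mathbf{S}=(B_1,\dots,B_\ell)$ of nonempty pairwise disjoint subsets with union $[n]$. Its alcoved simplex $\Delta_{\mathbf{S}}\subseteq\mathcal{H}_n$ is defined by: $x_i=x_j$ for all $i,j$ in a common block $B_k$; $x_i\ge x_j$ for all $i\in B_k$, $j\in B_{k+1}$, $1\le k\le \ell-1$; and $x_i\ge x_j-1$ for all $i\in B_\ell$, $j\in B_1$. For $I\subseteq[n]$, the restriction $\mathbf{S}|_I$ is the ordered set partition of $I$ obtained by intersecting each block with $I$ and deleting empty blocks (keeping the order). *)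

theory Defs
  imports "HOL-Analysis.Analysis"
begin

text \<open>
  The ground set [n] is the universe of a finite type \<open>'n\<close>. For \<open>I \<subseteq> [n]\<close>, the space
  \<open>\<real>\<^sup>I\<close> is identified with the coordinate subspace of \<open>real ^ 'n\<close> of vectors vanishing
  outside \<open>I\<close>. Minkowski sums are the sums of sets from \<open>Set_Algebras\<close>.
\<close>

definition zero_sum_space :: "'n set \<Rightarrow> (real ^ 'n::finite) set" where
  "zero_sum_space I = {x. (\<forall>i. i \<notin> I \<longrightarrow> x $ i = 0) \<and> (\<Sum>i\<in>I. x $ i) = 0}"

text \<open>\<open>E\<close> is the set of pairs for which an inequality is imposed; it need not contain every pair.\<close>

definition alcoved :: "'n set \<Rightarrow> (real ^ 'n::finite) set \<Rightarrow> bool" where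
  "alcoved I P \<longleftrightarrow> polytope P \<and>
     (\<exists>E (a :: 'n \<Rightarrow> 'n \<Rightarrow> real). E \<subseteq> {(i, j). i \<in> I \<and> j \<in> I \<and> i \<noteq> j} \<and>
        P = {x \<in> zero_sum_space I. \<forall>(i, j)\<in>E. x $ i - x $ j \<le> a i j})"

definition compatible :: "'n set \<Rightarrow> (real ^ 'n::finite) set \<Rightarrow> (real ^ 'n) set \<Rightarrow> bool" where
  "compatible I P Q \<longleftrightarrow> alcoved I P \<and> alcoved I Q \<and> alcoved I (P + Q)"

definition ordered_set_partition :: "'a set \<Rightarrow> 'a set list \<Rightarrow> bool" where
  "ordered_set_partition I S \<longleftrightarrow> distinct S \<and> partition_on I (set S)"

definition restrict_osp :: "'a set list \<Rightarrow> 'a set \<Rightarrow> 'a set list" where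
  "restrict_osp S I = filter (\<lambda>B. B \<noteq> {}) (map (\<lambda>B. B \<inter> I) S)"

text \<open>The ground set is the union of the blocks; the guard \<open>S \<noteq> []\<close> only matters for the empty
  partition of the empty set, whose simplex is the single point of the zero space.\<close>

definition alcoved_simplex :: "'n set list \<Rightarrow> (real ^ 'n::finite) set" where
  "alcoved_simplex S = {x \<in> zero_sum_space (\<Union>(set S)).
     (\<forall>B\<in>set S. \<forall>i\<in>B. \<forall>j\<in>B. x $ i = x $ j) \<and>
     (\<forall>k. Suc k < length S \<longrightarrow> (\<forall>i\<in>S ! k. \<forall>j\<in>S ! Suc k. x $ i \<ge> x $ j)) \<and>
     (S \<noteq> [] \<longrightarrow> (\<forall>i\<in>last S. \<forall>j\<in>hd S. x $ i \<ge> x $ j - 1))}"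

end

theory Submission
  imports Defs
begin

text \<open>
  If \<open>r\<close> numbers the blocks of \<open>S\<close>, the simplex of \<open>S|\<^sub>I\<close> is cut out by \<open>x\<^sub>i - x\<^sub>j \<le> cost r i j\<close> with
  tight right-hand sides. Hence two simplices (with block numbers \<open>r\<close>, \<open>s\<close>) are compatible iff every
  \<open>z\<close> satisfying the added-up inequalities splits as \<open>x + y\<close> with \<open>x\<close>, \<open>y\<close> in the two simplices. Such a \<open>z\<close> on \<open>I\<close>
  extends to all of [n] by the triangle inequality, so compatibility is inherited by restrictions.

  Splitting \<open>z\<close> is a system of difference constraints, so it fails only if there is a negative cycle
  \<open>p\<^sub>0 q\<^sub>0 p\<^sub>1 q\<^sub>1 \<dots>\<close>. An exchange argument shows that on a shortest one the pairs \<open>(q\<^sub>j, p\<^sub>j)\<close> are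
  disjoint arcs in the cyclic order of \<open>S\<close>, and the pairs \<open>(q\<^sub>j, p\<^sub>j\<^sub>+\<^sub>1)\<close> in that of \<open>T\<close>. Conversely any such
  configuration obstructs splitting on its support, whatever its length. If it has at least four pairs
  then either a shortcut gives two or three pairs, or \<open>q\<^sub>0, q\<^sub>1, q\<^sub>2, q\<^sub>3\<close> occur in opposite cyclic orders in
  \<open>S\<close> and \<open>T\<close>, which is itself a configuration with two pairs. So six elements suffice.
\<close>

section \<open>Arcs in a cyclic order and crossing cycles\<close>

definition cost :: "('a \<Rightarrow> nat) \<Rightarrow> 'a \<Rightarrow> 'a \<Rightarrow> real" where
  "cost r i j = (if r i < r j then 1 else 0)"

text \<open>Up to rotation, \<open>r q \<le> r p < r q' \<le> r p'\<close>; a rotation of the blocks only translates the simplex.\<close>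

definition alternating :: "('a \<Rightarrow> nat) \<Rightarrow> 'a \<Rightarrow> 'a \<Rightarrow> 'a \<Rightarrow> 'a \<Rightarrow> bool" where
  "alternating r q p q' p' \<longleftrightarrow>
     r q \<le> r p \<and> r p < r q' \<and> r q' \<le> r p' \<or>
     r p < r q' \<and> r q' \<le> r p' \<and> r p' < r q \<or>
     r q' \<le> r p' \<and> r p' < r q \<and> r q \<le> r p \<or>
     r p' < r q \<and> r q \<le> r p \<and> r p < r q'"

lemma alternating_sym: "alternating r q p q' p' \<longleftrightarrow> alternating r q' p' q p"
  unfolding alternating_def by auto

text \<open>\<open>cost r p q\<close> is 1 iff the upward arc from \<open>q\<close> to
  \<open>p\<close> passes the cut between last and first block. Swapping the ends of two disjoint
  arcs covers the circle once more, hence passes the cut once more.\<close>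

lemma alternating_iff_cost:
  "alternating r q p q' p' \<longleftrightarrow> cost r p q + cost r p' q' < cost r p q' + cost r p' q"
  unfolding alternating_def cost_def by auto

definition crossing_cycle ::
  "('a \<Rightarrow> nat) \<Rightarrow> ('a \<Rightarrow> nat) \<Rightarrow> nat \<Rightarrow> (nat \<Rightarrow> 'a) \<Rightarrow> (nat \<Rightarrow> 'a) \<Rightarrow> bool" where
  "crossing_cycle r s m q p \<longleftrightarrow> 2 \<le> m \<and> p m = p 0 \<and>
     (\<forall>i j. i < j \<and> j < m \<longrightarrow> alternating r (q i) (p i) (q j) (p j) \<and>
        alternating s (q i) (p (Suc i)) (q j) (p (Suc j)))"

section \<open>Shortening a crossing cycle to at most three pairs\<close>

text \<open>The four arcs are disjoint, and a negated alternation says that a long arc meets a third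
  one. So arc 1 lies between 0 and 2, arc 2 between 1 and 3, and the last hypothesis keeps 3 from
  lying between 0 and 1.\<close>

lemma cyclic_forward:
  assumes "alternating r q0 p0 q1 p1" "alternating r q0 p0 q2 p2" "alternating r q0 p0 q3 p3"
    "alternating r q1 p1 q2 p2" "alternating r q1 p1 q3 p3" "alternating r q2 p2 q3 p3"
    and "\<not> alternating r q1 p1 q0 p2" "\<not> alternating r q2 p2 q1 p3"
    and "\<not> (alternating r q1 p1 q0 p3 \<and> alternating r q2 p2 q0 p3)"
  shows "alternating r q0 q1 q2 q3"
  using assms unfolding alternating_def by (smt (verit) linorder_not_le order.trans nat_less_le)

text \<open>The same placement argument with long arcs from a higher index to a lower one, which
  reverses the order.\<close>

lemma cyclic_backward:
  assumes "alternating r q0 p1 q1 p2" "alternating r q0 p1 q2 p3" "alternating r q0 p1 q3 p4"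
    "alternating r q1 p2 q2 p3" "alternating r q1 p2 q3 p4" "alternating r q2 p3 q3 p4"
    and "\<not> alternating r q1 p2 q2 p1" "\<not> alternating r q2 p3 q3 p2"
    and "\<not> (alternating r q1 p2 q3 p1 \<and> alternating r q2 p3 q3 p1)"
  shows "alternating r q0 q3 q2 q1"
  using assms unfolding alternating_def by (smt (verit) linorder_not_le order.trans nat_less_le)

lemma crossing_cycle_2:
  assumes "alternating r q0 p0 q1 p1" "alternating s q0 p1 q1 p0"
  shows "crossing_cycle r s 2 ((!) [q0, q1]) ((!) [p0, p1, p0])"
  using assms by (auto simp: crossing_cycle_def less_Suc_eq numeral_eq_Suc)

lemma crossing_cycle_3:
  assumes "alternating r q0 p0 q1 p1" "alternating r q0 p0 q2 p2" "alternating r q1 p1 q2 p2"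
    "alternating s q0 p1 q1 p2" "alternating s q0 p1 q2 p0" "alternating s q1 p2 q2 p0"
  shows "crossing_cycle r s 3 ((!) [q0, q1, q2]) ((!) [p0, p1, p2, p0])"
  using assms by (auto simp: crossing_cycle_def less_Suc_eq numeral_eq_Suc)

lemma short_crossing_cycle:
  assumes cyc: "crossing_cycle r s m q p"
  shows "\<exists>k q' p'. k \<le> 3 \<and> crossing_cycle r s k q' p'"
proof (cases "m \<le> 3")
  case True
  with cyc show ?thesis by blast
next
  case False
  \<comment> \<open>Only the first four pairs are used; \<open>p 4\<close> may differ from
    \<open>p 0\<close>.\<close>
  have R: "alternating r (q i) (p i) (q j) (p j)"
    and S: "alternating s (q i) (p (Suc i)) (q j) (p (Suc j))" if "i < j" "j < 4" for i j
    using cyc False that by (auto simp: crossing_cycle_def)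
  have R01: "alternating r (q 0) (p 0) (q 1) (p 1)" and R02: "alternating r (q 0) (p 0) (q 2) (p 2)"
    and R03: "alternating r (q 0) (p 0) (q 3) (p 3)" and R12: "alternating r (q 1) (p 1) (q 2) (p 2)"
    and R13: "alternating r (q 1) (p 1) (q 3) (p 3)" and R23: "alternating r (q 2) (p 2) (q 3) (p 3)"
    using R by simp_all
  have S01: "alternating s (q 0) (p 1) (q 1) (p 2)" and S02: "alternating s (q 0) (p 1) (q 2) (p 3)"
    and S03: "alternating s (q 0) (p 1) (q 3) (p 4)" and S12: "alternating s (q 1) (p 2) (q 2) (p 3)"
    and S13: "alternating s (q 1) (p 2) (q 3) (p 4)" and S23: "alternating s (q 2) (p 3) (q 3) (p 4)"
    using S[of 0 1] S[of 0 2] S[of 0 3] S[of 1 2] S[of 1 3] S[of 2 3] by (simp_all add: numeral_eq_Suc)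
  show ?thesis
  proof (rule ccontr)
    assume no: "\<not> ?thesis"
    have no2: False if "alternating r a b c d" "alternating s a d c b" for a b c d
      using crossing_cycle_2[OF that] no by force
    have no3: False if "alternating r a b c d" "alternating r a b e f" "alternating r c d e f"
      "alternating s a d c f" "alternating s a d e b" "alternating s c f e b" for a b c d e f
      using crossing_cycle_3[OF that] no by force
    \<comment> \<open>Each excluded alternation is a shortcut that, with arcs known to be disjoint,
      would close to a crossing cycle of two or three pairs.\<close>
    have "alternating r (q 0) (q 1) (q 2) (q 3)"
    proof (rule cyclic_forward[where ?p0.0="p 0" and ?p1.0="p 1" and ?p2.0="p 2" and ?p3.0="p 3"])
      show "\<not> alternating r (q 1) (p 1) (q 0) (p 2)"
        using no2 S01 alternating_sym by metis
      show "\<not> alternating r (q 2) (p 2) (q 1) (p 3)"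
        using no2 S12 alternating_sym by metis
      show "\<not> (alternating r (q 1) (p 1) (q 0) (p 3) \<and> alternating r (q 2) (p 2) (q 0) (p 3))"
        using no3[of "q 1" "p 1" "q 2" "p 2" "q 0" "p 3"] R12 S01 S02 S12 alternating_sym by metis
    qed (use R01 R02 R03 R12 R13 R23 in simp_all)
    moreover have "alternating s (q 0) (q 3) (q 2) (q 1)"
    proof (rule cyclic_backward[where ?p1.0="p 1" and ?p2.0="p 2" and ?p3.0="p 3" and ?p4.0="p 4"])
      show "\<not> alternating s (q 1) (p 2) (q 2) (p 1)"
        using no2 R12 by metis
      show "\<not> alternating s (q 2) (p 3) (q 3) (p 2)"
        using no2 R23 by metis
      show "\<not> (alternating s (q 1) (p 2) (q 3) (p 1) \<and> alternating s (q 2) (p 3) (q 3) (p 1))"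
        using no3[of "q 1" "p 1" "q 2" "p 2" "q 3" "p 3"] R12 R13 R23 S12 by metis
    qed (use S01 S02 S03 S12 S13 S23 in simp_all)
    ultimately show False by (rule no2)
  qed
qed


section \<open>Crossing cycles obstruct splitting\<close>

text \<open>A vertex of the simplex before centring. It also rotates the blocks:
  \<open>cost r i j - (level r p i - level r p j)\<close> is the cost in the order rotated so that
  the block of \<open>p\<close> comes last.\<close>

definition level :: "('a \<Rightarrow> nat) \<Rightarrow> 'a \<Rightarrow> 'a \<Rightarrow> real" where
  "level r p i = (if r i \<le> r p then 1 else 0)"

lemma level_diff_le_cost: "level r p i - level r p j \<le> cost r i j"
  by (auto simp: level_def cost_def)

lemma level_diff_self: "level r p p - level r p q = cost r p q"
  by (auto simp: level_def cost_def)

text \<open>Once the block of \<open>p\<close> is last, an arc disjoint from the one ending at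
  \<open>p\<close> avoids the cut.\<close>

lemma level_diff_alternating:
  assumes "alternating r q p q' p'"
  shows "level r p p' - level r p q' = cost r p' q'"
  using assms by (auto simp: level_def cost_def alternating_def)

text \<open>In that rotation both ends of the other arc come strictly before
  \<open>q\<close>.\<close>

lemma level_diff_less_cost:
  assumes "alternating r q p q' p'" "i = q' \<or> i = p'"
  shows "level r p i - level r p q + 1 \<le> cost r i q"
  using assms by (auto simp: level_def cost_def alternating_def)

definition splits :: "'a set \<Rightarrow> ('a \<Rightarrow> nat) \<Rightarrow> ('a \<Rightarrow> nat) \<Rightarrow> bool" where
  "splits I r s \<longleftrightarrow>
     (\<forall>z. (\<forall>i\<in>I. \<forall>j\<in>I. z i - z j \<le> cost r i j + cost s i j) \<longrightarrow>
       (\<exists>x y. (\<forall>i\<in>I. z i = x i + y i) \<and>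
          (\<forall>i\<in>I. \<forall>j\<in>I. x i - x j \<le> cost r i j \<and> y i - y j \<le> cost s i j)))"

lemma splitsE:
  assumes "splits I r s" "\<And>i j. i \<in> I \<Longrightarrow> j \<in> I \<Longrightarrow> z i - z j \<le> cost r i j + cost s i j"
  obtains x y where "\<forall>i\<in>I. z i = x i + y i"
    "\<forall>i\<in>I. \<forall>j\<in>I. x i - x j \<le> cost r i j \<and> y i - y j \<le> cost s i j"
proof -
  have "\<forall>i\<in>I. \<forall>j\<in>I. z i - z j \<le> cost r i j + cost s i j"
    using assms(2) by blast
  from assms(1)[unfolded splits_def, THEN spec, THEN mp, OF this] show thesis
    by (elim exE conjE) (rule that)
qed

lemma sum_shift_cycle:
  fixes f :: "'a \<Rightarrow> real"
  assumes "p m = p 0"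
  shows "(\<Sum>j<m. f (p (Suc j))) = (\<Sum>j<m. f (p j))"
proof -
  have "(\<Sum>j<m. f (p (Suc j)) - f (p j)) = 0"
    using assms by (simp add: sum_lessThan_telescope[of "\<lambda>j. f (p j)"])
  then show ?thesis
    by (simp add: sum_subtractf)
qed

text \<open>Rotate the two orders so that the arcs \<open>(q\<^sub>0, p\<^sub>0)\<close> and \<open>(q\<^sub>0, p\<^sub>1)\<close> come last. Then the arcs cost nothing,
  and minus the indicator of \<open>q\<^sub>0\<close> satisfies the summed inequalities but has positive pairing with the
  cycle. Undoing the rotations adds the two level functions.\<close>

lemma crossing_cycle_not_splits:
  assumes cyc: "crossing_cycle r s m q p"
  shows "\<not> splits (q ` {..<m} \<union> p ` {..<m}) r s"
proof
  let ?I = "q ` {..<m} \<union> p ` {..<m}"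
  assume split: "splits ?I r s"
  have m: "2 \<le> m" and pm: "p m = p 0"
    using cyc by (auto simp: crossing_cycle_def)
  have R0: "alternating r (q 0) (p 0) (q j) (p j)"
    and S0: "alternating s (q 0) (p 1) (q j) (p (Suc j))" if "0 < j" "j < m" for j
    using cyc that by (auto simp: crossing_cycle_def)
  have S_last: "alternating s (q 0) (p 1) (q (m - 1)) (p 0)"
    using S0[of "m - 1"] m pm by simp
  define h where "h i = level r (p 0) i + level s (p 1) i" for i
  define z where "z i = h i - (if i = q 0 then 1 else 0)" for i
  have h_less: "h i - h (q 0) + 1 \<le> cost r i (q 0) + cost s i (q 0)" if "i \<in> ?I" "i \<noteq> q 0" for i
  proof -
    \<comment> \<open>\<open>p 0\<close> lies on the \<open>r\<close>-arc of \<open>q 0\<close>, so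
      its slack comes from \<open>s\<close>, where it ends the last arc because
      \<open>p m = p 0\<close>. All other vertices have slack from \<open>r\<close>.\<close>
    from that consider "i = p 0" | j where "0 < j" "j < m" "i = q j \<or> i = p j"
      by (auto; metis gr0I)
    then show ?thesis
    proof cases
      case 1
      show ?thesis
        using level_diff_less_cost[OF S_last, of i] level_diff_le_cost[of r "p 0" i "q 0"] 1
        by (simp add: h_def)
    next
      case 2
      show ?thesis
        using level_diff_less_cost[OF R0[OF 2(1,2)] 2(3)] level_diff_le_cost[of s "p 1" i "q 0"]
        by (simp add: h_def)
    qed
  qed
  have h_le: "h i - h j \<le> cost r i j + cost s i j" for i j
    using level_diff_le_cost[of r "p 0" i j] level_diff_le_cost[of s "p 1" i j] by (simp add: h_def)
  have "z i - z j \<le> cost r i j + cost s i j" if "i \<in> ?I" for i j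
    using h_less[OF that] h_le[of i j] by (auto simp: z_def)
  then obtain x y where "\<forall>i\<in>?I. z i = x i + y i"
    "\<forall>i\<in>?I. \<forall>j\<in>?I. x i - x j \<le> cost r i j \<and> y i - y j \<le> cost s i j"
    by (rule splitsE[OF split])
  then have xy: "\<And>i. i \<in> ?I \<Longrightarrow> z i = x i + y i"
    and x: "\<And>i j. i \<in> ?I \<Longrightarrow> j \<in> ?I \<Longrightarrow> x i - x j \<le> cost r i j"
    and y: "\<And>i j. i \<in> ?I \<Longrightarrow> j \<in> ?I \<Longrightarrow> y i - y j \<le> cost s i j"
    by simp_all
  have pI: "p (Suc j) \<in> ?I" if "j < m" for j
    using that pm m by (cases "Suc j = m") auto
  have "x (p j) - x (q j) \<le> level r (p 0) (p j) - level r (p 0) (q j)" if "j < m" for j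
    using x[of "p j" "q j"] that level_diff_self[of r "p 0" "q 0"] level_diff_alternating[OF R0[of j]]
    by (cases "j = 0") auto
  then have 1: "(\<Sum>j<m. x (p j) - x (q j)) \<le> (\<Sum>j<m. level r (p 0) (p j) - level r (p 0) (q j))"
    by (intro sum_mono) auto
  have "y (p (Suc j)) - y (q j) \<le> level s (p 1) (p (Suc j)) - level s (p 1) (q j)" if "j < m" for j
    using y[OF pI[OF that], of "q j"] that level_diff_self[of s "p 1" "q 0"]
      level_diff_alternating[OF S0[of j]]
    by (cases "j = 0") auto
  then have 2: "(\<Sum>j<m. y (p (Suc j)) - y (q j))
      \<le> (\<Sum>j<m. level s (p 1) (p (Suc j)) - level s (p 1) (q j))"
    by (intro sum_mono) auto
  have "z (p j) - z (q j) = x (p j) + y (p j) - (x (q j) + y (q j))" if "j < m" for j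
    using that by (simp add: xy)
  then have "(\<Sum>j<m. z (p j) - z (q j)) = (\<Sum>j<m. x (p j) + y (p j) - (x (q j) + y (q j)))"
    by simp
  \<comment> \<open>As the cycle closes, \<open>y (p j)\<close> may be replaced by
    \<open>y (p (Suc j))\<close> under the sum; then \<open>x\<close> runs along the arcs of
    \<open>r\<close> and \<open>y\<close> along those of \<open>s\<close>.\<close>
  also have "\<dots> \<le> (\<Sum>j<m. h (p j) - h (q j))"
    using 1 2 sum_shift_cycle[where f=y, OF pm] sum_shift_cycle[where f="level s (p 1)", OF pm]
    by (simp add: h_def sum_subtractf sum.distrib)
  finally have le: "(\<Sum>j<m. z (p j) - z (q j)) \<le> (\<Sum>j<m. h (p j) - h (q j))" .
  have "p j \<noteq> q 0" if "j < m" for j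
    using that R0[of j] S_last by (cases "j = 0") (auto simp: alternating_def)
  then have zp: "h (p j) - h (q j) \<le> z (p j) - z (q j)" if "j < m" for j
    using that by (auto simp: z_def)
  \<comment> \<open>Lowering \<open>q 0\<close> raises the sum: \<open>q 0\<close> is subtracted at
    \<open>j = 0\<close> and never occurs as a \<open>p j\<close>.\<close>
  have "(\<Sum>j<m. h (p j) - h (q j)) < (\<Sum>j<m. z (p j) - z (q j))"
  proof (rule sum_strict_mono_ex1)
    show "\<exists>j\<in>{..<m}. h (p j) - h (q j) < z (p j) - z (q j)"
      using \<open>\<And>j. j < m \<Longrightarrow> p j \<noteq> q 0\<close> m by (intro bexI[of _ 0]) (auto simp: z_def)
  qed (use zp in auto)
  with le show False by simp
qed

section \<open>Negative cycles of difference constraints\<close>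

text \<open>Each step has a middle element \<open>e\<close>; later the vertices become the
  \<open>p\<close>'s and the middle elements the \<open>q\<close>'s.\<close>

inductive walk :: "('a \<Rightarrow> 'a \<Rightarrow> 'a \<Rightarrow> real) \<Rightarrow> 'a \<Rightarrow> 'a \<Rightarrow> nat \<Rightarrow> real \<Rightarrow> bool"
  for w :: "'a \<Rightarrow> 'a \<Rightarrow> 'a \<Rightarrow> real" where
  walk_Nil: "walk w u u 0 0"
| walk_snoc: "walk w u v n c \<Longrightarrow> walk w u v' (Suc n) (c + w v e v')"

lemma walk_append:
  assumes "walk w v t n d" "walk w u v m c"
  shows "walk w u t (m + n) (c + d)"
  using assms
  by (induction rule: walk.induct) (auto simp: add.assoc[symmetric] intro: walk_snoc)

lemma walk_vertices:
  assumes "walk w u v n c"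
  obtains p q where "p 0 = u" "p n = v" "c = (\<Sum>j<n. w (p j) (q j) (p (Suc j)))"
proof -
  have "\<exists>p q. p 0 = u \<and> p n = v \<and> c = (\<Sum>j<n. w (p j) (q j) (p (Suc j)))"
    using assms
  proof (induction rule: walk.induct)
    case (walk_Nil u)
    then show ?case by auto
  next
    case (walk_snoc u v n c v' e)
    then obtain p q where pq: "p 0 = u" "p n = v" "c = (\<Sum>j<n. w (p j) (q j) (p (Suc j)))"
      by auto
    have "(\<Sum>j<n. w ((p(Suc n := v')) j) ((q(n := e)) j) ((p(Suc n := v')) (Suc j))) = c"
      unfolding pq by (intro sum.cong) auto
    with pq show ?case
      by (intro exI[of _ "p(Suc n := v')"] exI[of _ "q(n := e)"]) simp
  qed
  with that show thesis by blast
qed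

lemma walk_segment:
  assumes "s \<le> t"
  shows "walk w (p s) (p t) (t - s) (\<Sum>j=s..<t. w (p j) (q j) (p (Suc j)))"
  using assms
proof (induction t rule: dec_induct)
  case base
  show ?case by (simp add: walk_Nil)
next
  case (step t)
  from walk_snoc[OF step.IH, of "p (Suc t)" "q t"] step.hyps show ?case
    by (simp add: Suc_diff_le)
qed

text \<open>The potential is the infimal weight of a walk from a base point. It is finite because every
  walk can be closed up by one more step.\<close>

lemma ex_potential:
  fixes w :: "'a \<Rightarrow> 'a \<Rightarrow> 'a \<Rightarrow> real"
  assumes closed: "\<And>u n c. walk w u u n c \<Longrightarrow> 0 \<le> c"
  obtains x where "\<And>i e j. x i - x j \<le> w i e j"
proof -
  fix k :: 'a
  define C where "C j = {c. \<exists>n. walk w k j n c}" for j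
  have lower: "- w j j k \<le> c" if "c \<in> C j" for c j
    using that closed walk_snoc[of w k j _ c k j] by (force simp: C_def)
  then have bdd: "bdd_below (C j)" for j
    by (meson bdd_belowI)
  have nonempty: "C j \<noteq> {}" for j
    using walk_snoc[OF walk_Nil, of w k j k] by (force simp: C_def)
  have "Inf (C j) - w i e j \<le> Inf (C i)" for i e j
  proof (rule cInf_greatest[OF nonempty])
    fix c assume "c \<in> C i"
    then have "c + w i e j \<in> C j"
      by (auto simp: C_def intro: walk_snoc)
    then show "Inf (C j) - w i e j \<le> c"
      using cInf_lower[OF _ bdd] by fastforce
  qed
  then show thesis
    by (intro that[of "\<lambda>i. - Inf (C i)"]) (simp add: algebra_simps)
qed

text \<open>On a shortest negative cycle, exchanging the partners of two arcs splits the cycle into two shorter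
  ones, which are nonnegative; so the exchange strictly increases the cost.\<close>

lemma not_splits_crossing_cycle:
  assumes "\<not> splits UNIV r s"
  obtains m q p where "crossing_cycle r s m q p"
proof -
  from assms obtain z where z: "\<And>i j. z i - z j \<le> cost r i j + cost s i j"
    and no_split: "\<not> (\<exists>x y. (\<forall>i. z i = x i + y i) \<and>
          (\<forall>i j. x i - x j \<le> cost r i j \<and> y i - y j \<le> cost s i j))"
    unfolding splits_def by auto
  \<comment> \<open>With \<open>y = z - x\<close>, the constraints
    \<open>x a - x e \<le> cost r a e\<close> and \<open>y b - y e \<le> cost s b e\<close> add up
    to \<open>x a - x b \<le> w a e b\<close>.\<close>
  define w where "w a e b = cost r a e + cost s b e - (z b - z e)" for a e b
  define negative where "negative n \<longleftrightarrow> (\<exists>u c. walk w u u n c \<and> c < 0)" for n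
  have "\<exists>n. negative n"
  proof (rule ccontr)
    assume "\<not> ?thesis"
    then have "\<And>u n c. walk w u u n c \<Longrightarrow> 0 \<le> c"
      unfolding negative_def by force
    then obtain x where x: "\<And>i e j. x i - x j \<le> w i e j"
      using ex_potential by blast
    \<comment> \<open>A middle element equal to an endpoint makes one cost vanish and recovers the
      separate constraints.\<close>
    have "x i - x j \<le> cost r i j" for i j
      using x[of i j j] by (simp add: w_def cost_def)
    moreover have "(z i - x i) - (z j - x j) \<le> cost s i j" for i j
      using x[of j i j] by (simp add: w_def cost_def)
    ultimately have "(\<forall>i. z i = x i + (z i - x i)) \<and>
        (\<forall>i j. x i - x j \<le> cost r i j \<and> z i - x i - (z j - x j) \<le> cost s i j)"
      by simp
    with no_split[simplified not_ex, THEN spec, THEN spec, of x "\<lambda>i. z i - x i"] show False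
      by (rule notE)
  qed
  then obtain m where "negative m" and min: "\<And>n. n < m \<Longrightarrow> \<not> negative n"
    using exists_least_iff[of negative] by blast
  then obtain u c where walk: "walk w u u m c" and neg: "c < 0"
    unfolding negative_def by blast
  from walk obtain p q where p0: "p 0 = u" and pm: "p m = u"
    and c: "c = (\<Sum>j<m. w (p j) (q j) (p (Suc j)))"
    by (rule walk_vertices)
  have "m \<noteq> 0"
    using c neg by (intro notI) simp
  moreover have "m \<noteq> 1"
  proof
    assume "m = 1"
    then have "c = w u (q 0) u"
      using c p0 pm by simp
    with neg z[of u "q 0"] show False
      by (simp add: w_def)
  qed
  ultimately have m: "2 \<le> m" by simp
  have "alternating r (q i) (p i) (q j) (p j) \<and>
      alternating s (q i) (p (Suc i)) (q j) (p (Suc j))" if ij: "i < j" "j < m" for i j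
  proof -
    let ?f = "\<lambda>k. w (p k) (q k) (p (Suc k))"
    define c1 where "c1 = (\<Sum>k=Suc i..<j. ?f k)"
    define c2 where "c2 = (\<Sum>k=Suc j..<m. ?f k) + (\<Sum>k=0..<i. ?f k)"
    define n1 where "n1 = j - Suc i"
    define n2 where "n2 = m - Suc j + i"
    have walk1: "walk w (p (Suc i)) (p j) n1 c1"
      unfolding c1_def n1_def using walk_segment[of "Suc i" j w p q] ij by simp
    have "walk w (p 0) (p i) i (\<Sum>k=0..<i. ?f k)"
      using walk_segment[of 0 i w p q] by simp
    moreover have "walk w (p (Suc j)) (p 0) (m - Suc j) (\<Sum>k=Suc j..<m. ?f k)"
      using walk_segment[of "Suc j" m w p q] ij p0 pm by simp
    ultimately have walk2: "walk w (p (Suc j)) (p i) n2 c2"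
      unfolding c2_def n2_def by (rule walk_append)
    have total: "c = ?f i + c1 + ?f j + c2"
    proof -
      have "c = (\<Sum>k=0..<m. ?f k)"
        by (simp add: c atLeast0LessThan)
      also have "\<dots> = (\<Sum>k=0..<i. ?f k) + (\<Sum>k=i..<m. ?f k)"
        using ij by (simp add: sum.atLeastLessThan_concat)
      also have "(\<Sum>k=i..<m. ?f k) = ?f i + (\<Sum>k=Suc i..<m. ?f k)"
        using ij by (simp add: sum.atLeast_Suc_lessThan)
      also have "(\<Sum>k=Suc i..<m. ?f k) = c1 + (\<Sum>k=j..<m. ?f k)"
        unfolding c1_def using ij by (subst sum.atLeastLessThan_concat) auto
      also have "(\<Sum>k=j..<m. ?f k) = ?f j + (\<Sum>k=Suc j..<m. ?f k)"
        using ij by (simp add: sum.atLeast_Suc_lessThan)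
      finally show ?thesis
        by (simp add: c2_def)
    qed
    have short: "Suc n1 < m" "Suc n2 < m"
      using ij by (auto simp: n1_def n2_def)
    have close1: "0 \<le> c1 + w (p j) e (p (Suc i))" for e
      using min[OF short(1)] walk_snoc[OF walk1] unfolding negative_def by (meson not_le)
    have close2: "0 \<le> c2 + w (p i) e (p (Suc j))" for e
      using min[OF short(2)] walk_snoc[OF walk2] unfolding negative_def by (meson not_le)
    \<comment> \<open>Closing the two pieces with \<open>q i\<close> and \<open>q j\<close> swaps
      partners in \<open>r\<close> only, closing with \<open>q j\<close> and \<open>q i\<close> in
      \<open>s\<close> only. The \<open>z\<close> terms do not change in total, so the cost must
      rise.\<close>
    show ?thesis
      using total neg close1[of "q i"] close2[of "q j"] close1[of "q j"] close2[of "q i"]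
      by (simp add: alternating_iff_cost w_def)
  qed
  with m p0 pm show thesis
    by (intro that[of m q p]) (simp add: crossing_cycle_def)
qed

section \<open>Restriction to subsets and the bound six\<close>

lemma cost_triangle: "cost r i k \<le> cost r i j + cost r j k"
  by (auto simp: cost_def)

lemma splits_subset:
  assumes split: "splits UNIV r s" and fin: "finite (I :: 'a set)"
  shows "splits I r s"
proof (cases "I = {}")
  case True
  then show ?thesis by (simp add: splits_def)
next
  case False
  show ?thesis
    unfolding splits_def
  proof (intro allI impI)
    fix z :: "'a \<Rightarrow> real"
    define c where "c i j = cost r i j + cost s i j" for i j
    assume "\<forall>i\<in>I. \<forall>j\<in>I. z i - z j \<le> cost r i j + cost s i j"
    then have z: "\<And>i j. i \<in> I \<Longrightarrow> j \<in> I \<Longrightarrow> z i \<le> z j + c i j"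
      by (force simp: c_def)
    \<comment> \<open>The largest extension of \<open>z\<close> obeying the inequalities, as in
      McShane's extension of Lipschitz functions.\<close>
    define z' where "z' k = Min ((\<lambda>j. z j + c k j) ` I)" for k
    have z'_le: "z' k \<le> z j + c k j" if "j \<in> I" for k j
      unfolding z'_def using fin that by (intro Min_le) auto
    have z'_eq: "\<exists>j\<in>I. z' k = z j + c k j" for k
      unfolding z'_def using Min_in[of "(\<lambda>j. z j + c k j) ` I"] fin False by fast
    have z': "z' k - z' l \<le> c k l" for k l
    proof -
      obtain j where "j \<in> I" "z' l = z j + c l j" using z'_eq by blast
      with z'_le[of j k] show ?thesis
        using cost_triangle[of r k j l] cost_triangle[of s k j l] by (simp add: c_def)
    qed
    have agree: "z' i = z i" if "i \<in> I" for i
    proof (rule antisym)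
      show "z' i \<le> z i" using z'_le[OF that, of i] by (simp add: c_def cost_def)
      show "z i \<le> z' i" using z'_eq[of i] z[OF that] by auto
    qed
    obtain x y where "\<forall>i\<in>UNIV. z' i = x i + y i"
      "\<forall>i\<in>UNIV. \<forall>j\<in>UNIV. x i - x j \<le> cost r i j \<and> y i - y j \<le> cost s i j"
      using z'[unfolded c_def] by (rule splitsE[OF split])
    then show "\<exists>x y. (\<forall>i\<in>I. z i = x i + y i) \<and>
          (\<forall>i\<in>I. \<forall>j\<in>I. x i - x j \<le> cost r i j \<and> y i - y j \<le> cost s i j)"
      using agree by (intro exI[of _ x] exI[of _ y]) auto
  qed
qed

lemma splits_local:
  fixes r s :: "'a::finite \<Rightarrow> nat"
  shows "splits UNIV r s \<longleftrightarrow> (\<forall>I. card I \<le> 6 \<longrightarrow> splits I r s)"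
proof
  assume "splits UNIV r s"
  then show "\<forall>I. card I \<le> 6 \<longrightarrow> splits I r s"
    by (simp add: splits_subset)
next
  assume small: "\<forall>I. card I \<le> 6 \<longrightarrow> splits I r s"
  show "splits UNIV r s"
  proof (rule ccontr)
    assume "\<not> splits UNIV r s"
    then obtain m q p where "m \<le> 3" and cyc: "crossing_cycle r s m q p"
      by (meson not_splits_crossing_cycle short_crossing_cycle)
    \<comment> \<open>Three \<open>q\<close>'s and three \<open>p\<close>'s at most: this is the
      source of the six.\<close>
    have "card (q ` {..<m} \<union> p ` {..<m}) \<le> m + m"
      using card_Un_le[of "q ` {..<m}" "p ` {..<m}"] card_image_le[of "{..<m}" q]
        card_image_le[of "{..<m}" p] by simp
    with \<open>m \<le> 3\<close> small crossing_cycle_not_splits[OF cyc] show False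
      by simp
  qed
qed

section \<open>Polytopes of difference inequalities and their sums\<close>

definition diff_polytope :: "'n set \<Rightarrow> ('n \<Rightarrow> 'n \<Rightarrow> real) \<Rightarrow> (real ^ 'n::finite) set" where
  "diff_polytope I c = {x \<in> zero_sum_space I. \<forall>i\<in>I. \<forall>j\<in>I. x $ i - x $ j \<le> c i j}"

lemma subspace_zero_sum_space: "subspace (zero_sum_space I)"
  by (auto simp: subspace_def zero_sum_space_def sum.distrib sum_distrib_left[symmetric])

text \<open>Bounded because a coordinate beyond \<open>B\<close> in absolute value would give all
  coordinates on \<open>I\<close> its sign, against the zero sum. The nonnegative diagonal makes the
  pairs \<open>i = j\<close> vacuous.\<close>

lemma alcoved_diff_polytope:
  fixes I :: "'n::finite set"
  assumes nonneg: "\<And>i. 0 \<le> c i i" and bound: "\<And>i j. c i j \<le> B"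
  shows "alcoved I (diff_polytope I c)"
proof -
  let ?H = "\<lambda>i j. {x :: real ^ 'n. x $ i - x $ j \<le> c i j}"
  have eq: "diff_polytope I c = zero_sum_space I \<inter> \<Inter> ((\<lambda>(i, j). ?H i j) ` (I \<times> I))"
    by (auto simp: diff_polytope_def)
  have "polyhedron (?H i j)" for i j
    using polyhedron_halfspace_le[of "axis i 1 - axis j 1 :: real ^ 'n" "c i j"]
    by (simp add: inner_diff_left inner_axis')
  then have "polyhedron (diff_polytope I c)"
    unfolding eq
    by (intro polyhedron_Int polyhedron_Inter)
      (auto intro: affine_imp_polyhedron subspace_imp_affine subspace_zero_sum_space)
  moreover have "diff_polytope I c \<subseteq> cbox (\<chi> i. - B) (\<chi> i. B)"
  proof
    fix x assume x: "x \<in> diff_polytope I c"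
    have B: "0 \<le> B" using nonneg bound order_trans by blast
    have diff: "x $ i - x $ j \<le> B" if "i \<in> I" "j \<in> I" for i j
      using x that bound[of i j] by (force simp: diff_polytope_def)
    have sum0: "(\<Sum>i\<in>I. x $ i) = 0" and out: "\<And>i. i \<notin> I \<Longrightarrow> x $ i = 0"
      using x by (auto simp: diff_polytope_def zero_sum_space_def)
    have "- B \<le> x $ i \<and> x $ i \<le> B" for i
    proof (cases "i \<in> I")
      case True
      have "\<not> x $ i > B"
      proof
        assume "x $ i > B"
        then have "\<forall>j\<in>I. 0 < x $ j" using diff[OF True] by force
        then have "0 < (\<Sum>j\<in>I. x $ j)" using True by (intro sum_pos) auto
        with sum0 show False by simp
      qed
      moreover have "\<not> x $ i < - B"
      proof
        assume "x $ i < - B"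
        then have "\<forall>j\<in>I. 0 < - x $ j" using diff[OF _ True] by force
        then have "0 < (\<Sum>j\<in>I. - x $ j)" using True by (intro sum_pos) auto
        with sum0 show False by (simp add: sum_negf)
      qed
      ultimately show ?thesis by simp
    next
      case False
      then show ?thesis using out B by simp
    qed
    then show "x \<in> cbox (\<chi> i. - B) (\<chi> i. B)"
      by (simp add: mem_box_cart)
  qed
  then have "bounded (diff_polytope I c)"
    using bounded_cbox bounded_subset by blast
  ultimately have "polytope (diff_polytope I c)"
    by (simp add: polytope_eq_bounded_polyhedron)
  moreover have "diff_polytope I c = {x \<in> zero_sum_space I.
      \<forall>(i, j)\<in>{(i, j). i \<in> I \<and> j \<in> I \<and> i \<noteq> j}. x $ i - x $ j \<le> c i j}"
    using nonneg by (fastforce simp: diff_polytope_def)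
  ultimately show ?thesis
    unfolding alcoved_def by blast
qed

definition center :: "'n set \<Rightarrow> ('n \<Rightarrow> real) \<Rightarrow> real ^ 'n::finite" where
  "center I f = (\<chi> i. if i \<in> I then f i - (\<Sum>k\<in>I. f k) / card I else 0)"

lemma center_in_zero_sum_space: "center I f \<in> zero_sum_space I"
  by (cases "I = {}") (auto simp: center_def zero_sum_space_def sum_subtractf)

lemma center_diff: "i \<in> I \<Longrightarrow> j \<in> I \<Longrightarrow> center I f $ i - center I f $ j = f i - f j"
  by (simp add: center_def)

lemma center_in_diff_polytope:
  "center I f \<in> diff_polytope I c \<longleftrightarrow> (\<forall>i\<in>I. \<forall>j\<in>I. f i - f j \<le> c i j)"
  by (simp add: diff_polytope_def center_in_zero_sum_space center_diff)

lemma center_add: "center I (\<lambda>i. f i + g i) = center I f + center I g"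
  by (simp add: center_def vec_eq_iff sum.distrib add_divide_distrib)

lemma center_cong: "(\<And>i. i \<in> I \<Longrightarrow> f i = g i) \<Longrightarrow> center I f = center I g"
  by (simp add: center_def vec_eq_iff)

lemma center_zero_sum: "x \<in> zero_sum_space I \<Longrightarrow> center I (($) x) = x"
  by (auto simp: center_def zero_sum_space_def vec_eq_iff)

lemma compatible_iff_splits:
  fixes I :: "'n::finite set"
  shows "compatible I (diff_polytope I (cost r)) (diff_polytope I (cost s)) \<longleftrightarrow> splits I r s"
    (is "compatible I ?P ?Q \<longleftrightarrow> _")
proof -
  let ?R = "diff_polytope I (\<lambda>i j. cost r i j + cost s i j)"
  have alc: "alcoved I ?P" "alcoved I ?Q"
    by (rule alcoved_diff_polytope[where B=1]; simp add: cost_def)+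
  have alcR: "alcoved I ?R"
    by (rule alcoved_diff_polytope[where B=2]; simp add: cost_def)
  have sub: "?P + ?Q \<subseteq> ?R"
  proof
    fix x assume "x \<in> ?P + ?Q"
    then obtain a b where ab: "a \<in> ?P" "b \<in> ?Q" "x = a + b"
      by (auto elim: set_plus_elim)
    have "x \<in> zero_sum_space I"
      using ab subspace_add[OF subspace_zero_sum_space] by (auto simp: diff_polytope_def)
    moreover have "x $ i - x $ j \<le> cost r i j + cost s i j" if "i \<in> I" "j \<in> I" for i j
    proof -
      have "a $ i - a $ j \<le> cost r i j" "b $ i - b $ j \<le> cost s i j"
        using ab that by (auto simp: diff_polytope_def)
      then show ?thesis using ab(3) by simp
    qed
    ultimately show "x \<in> ?R"
      by (simp add: diff_polytope_def)
  qed
  have "alcoved I (?P + ?Q) \<longleftrightarrow> ?R \<subseteq> ?P + ?Q"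
  proof
    assume "?R \<subseteq> ?P + ?Q"
    with sub alcR show "alcoved I (?P + ?Q)" by (metis subset_antisym)
  next
    assume "alcoved I (?P + ?Q)"
    then obtain E a where E: "E \<subseteq> {(i, j). i \<in> I \<and> j \<in> I \<and> i \<noteq> j}"
      and PQ: "?P + ?Q = {x \<in> zero_sum_space I. \<forall>(i, j)\<in>E. x $ i - x $ j \<le> a i j}"
      unfolding alcoved_def by blast
    have "cost r i j + cost s i j \<le> a i j" if "(i, j) \<in> E" for i j
    proof -
      have ij: "i \<in> I" "j \<in> I" using that E by auto
      \<comment> \<open>These vertices attain \<open>cost r i j\<close> and
        \<open>cost s i j\<close> for every \<open>j\<close>, so any valid bound
        \<open>a i j\<close> is at least the bound of \<open>?R\<close>.\<close>
      have "center I (level r i) + center I (level s i) \<in> ?P + ?Q"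
        by (intro set_plus_intro) (simp_all add: center_in_diff_polytope level_diff_le_cost)
      then have "(center I (level r i) + center I (level s i)) $ i
          - (center I (level r i) + center I (level s i)) $ j \<le> a i j"
        using that PQ by blast
      then show ?thesis
        using center_diff[OF ij, of "level r i"] center_diff[OF ij, of "level s i"]
        by (simp add: level_diff_self)
    qed
    then have "?R \<subseteq> {x \<in> zero_sum_space I. \<forall>(i, j)\<in>E. x $ i - x $ j \<le> a i j}"
      using E unfolding diff_polytope_def by fastforce
    then show "?R \<subseteq> ?P + ?Q"
      unfolding PQ .
  qed
  also have "\<dots> \<longleftrightarrow> splits I r s"
  proof
    assume R: "?R \<subseteq> ?P + ?Q"
    show "splits I r s"
      unfolding splits_def
    proof (intro allI impI)
      fix z assume "\<forall>i\<in>I. \<forall>j\<in>I. z i - z j \<le> cost r i j + cost s i j"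
      then have "center I z \<in> ?P + ?Q"
        using R by (auto simp: center_in_diff_polytope)
      then obtain a b where ab: "a \<in> ?P" "b \<in> ?Q" "center I z = a + b"
        by (auto elim: set_plus_elim)
      \<comment> \<open>The mean that centring removed from \<open>z\<close> is given back to the
        first summand.\<close>
      define t where "t = (\<Sum>k\<in>I. z k) / card I"
      have "z i = (a $ i + t) + b $ i" if "i \<in> I" for i
        using arg_cong[OF ab(3), of "\<lambda>v. v $ i"] that by (simp add: center_def t_def)
      moreover have "(a $ i + t) - (a $ j + t) \<le> cost r i j" "b $ i - b $ j \<le> cost s i j"
        if "i \<in> I" "j \<in> I" for i j
        using ab that by (auto simp: diff_polytope_def)
      ultimately show "\<exists>x y. (\<forall>i\<in>I. z i = x i + y i) \<and>
          (\<forall>i\<in>I. \<forall>j\<in>I. x i - x j \<le> cost r i j \<and> y i - y j \<le> cost s i j)"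
        by (intro exI[of _ "\<lambda>i. a $ i + t"] exI[of _ "($) b"]) auto
    qed
  next
    assume split: "splits I r s"
    show "?R \<subseteq> ?P + ?Q"
    proof
      fix z assume z: "z \<in> ?R"
      then have "z $ i - z $ j \<le> cost r i j + cost s i j" if "i \<in> I" "j \<in> I" for i j
        using that by (simp add: diff_polytope_def)
      then obtain x y where xy: "\<forall>i\<in>I. z $ i = x i + y i"
        and le: "\<forall>i\<in>I. \<forall>j\<in>I. x i - x j \<le> cost r i j \<and> y i - y j \<le> cost s i j"
        by (rule splitsE[OF split])
      have "z = center I (($) z)"
        using z by (simp add: diff_polytope_def center_zero_sum)
      also have "\<dots> = center I x + center I y"
        using xy by (simp add: center_add[symmetric] cong: center_cong)
      also have "\<dots> \<in> ?P + ?Q"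
        using le by (intro set_plus_intro) (simp_all add: center_in_diff_polytope)
      finally show "z \<in> ?P + ?Q" .
    qed
  qed
  finally show ?thesis
    using alc by (simp add: compatible_def)
qed

section \<open>Block numberings and alcoved simplices\<close>

text \<open>Numbers may skip values, so one \<open>r\<close> serves a partition and all its
  restrictions.\<close>

definition ranked :: "('a \<Rightarrow> nat) \<Rightarrow> 'a set list \<Rightarrow> bool" where
  "ranked r S \<longleftrightarrow> {} \<notin> set S \<and> (\<forall>B\<in>set S. \<forall>i\<in>B. \<forall>j\<in>B. r i = r j) \<and>
     sorted_wrt (\<lambda>B C. \<forall>i\<in>B. \<forall>j\<in>C. r i < r j) S"

lemma ranked_exists:
  assumes "ordered_set_partition I S"
  shows "\<exists>r. ranked r S"
proof -
  define r where "r i = (SOME k. k < length S \<and> i \<in> S ! k)" for i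
  have r: "r i = k" if "k < length S" "i \<in> S ! k" for i k
  proof -
    have *: "r i < length S \<and> i \<in> S ! r i"
      unfolding r_def by (rule someI[of _ k]) (use that in simp)
    have "S ! r i = S ! k"
      using * that assms
      by (auto simp: ordered_set_partition_def partition_on_def disjoint_def disjnt_def pairwise_def)
        (metis IntI empty_iff nth_mem)+
    with * that assms show ?thesis
      by (simp add: ordered_set_partition_def nth_eq_iff_index_eq)
  qed
  have "ranked r S"
    unfolding ranked_def sorted_wrt_iff_nth_less
  proof (intro conjI ballI allI impI)
    show "{} \<notin> set S"
      using assms by (auto simp: ordered_set_partition_def partition_on_def)
    show "r i = r j" if "B \<in> set S" "i \<in> B" "j \<in> B" for B i j
      using that r by (metis in_set_conv_nth)
    show "r i < r j" if "k < l" "l < length S" "i \<in> S ! k" "j \<in> S ! l" for k l i j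
      using that r[of k i] r[of l j] by simp
  qed
  then show ?thesis by blast
qed

lemma ranked_restrict:
  assumes "ranked r S"
  shows "ranked r (restrict_osp S I)"
proof -
  have "sorted_wrt (\<lambda>B C. \<forall>i\<in>B. \<forall>j\<in>C. r i < r j) S"
    using assms unfolding ranked_def by (elim conjE)
  then have "sorted_wrt (\<lambda>B C. \<forall>i\<in>B \<inter> I. \<forall>j\<in>C \<inter> I. r i < r j) S"
    by (rule sorted_wrt_mono_rel[rotated]) blast
  then have "sorted_wrt (\<lambda>B C. \<forall>i\<in>B. \<forall>j\<in>C. r i < r j) (restrict_osp S I)"
    unfolding restrict_osp_def by (intro sorted_wrt_filter) (simp add: sorted_wrt_map)
  moreover have "\<forall>B\<in>set S. \<forall>i\<in>B. \<forall>j\<in>B. r i = r j"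
    using assms unfolding ranked_def by (elim conjE)
  then have "\<forall>B\<in>set (restrict_osp S I). \<forall>i\<in>B. \<forall>j\<in>B. r i = r j"
    by (auto simp: restrict_osp_def)
  moreover have "{} \<notin> set (restrict_osp S I)"
    by (simp add: restrict_osp_def)
  ultimately show ?thesis
    unfolding ranked_def by (intro conjI)
qed

lemma Union_restrict_osp: "\<Union> (set (restrict_osp S I)) = \<Union> (set S) \<inter> I"
  by (auto simp: restrict_osp_def)

lemma alcoved_simplex_eq_diff_polytope:
  assumes "ranked r S"
  shows "alcoved_simplex S = diff_polytope (\<Union> (set S)) (cost r)"
proof (intro subset_antisym subsetI)
  have const: "\<And>B i j. B \<in> set S \<Longrightarrow> i \<in> B \<Longrightarrow> j \<in> B \<Longrightarrow> r i = r j"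
    and less: "\<And>k l i j. k < l \<Longrightarrow> l < length S \<Longrightarrow> i \<in> S ! k \<Longrightarrow> j \<in> S ! l \<Longrightarrow> r i < r j"
    and nonempty: "\<And>k. k < length S \<Longrightarrow> S ! k \<noteq> {}"
    using assms unfolding ranked_def sorted_wrt_iff_nth_less by (blast, blast, metis nth_mem)
  fix x :: "real ^ 'a"
  {
    assume x: "x \<in> alcoved_simplex S"
    have eq: "\<And>B i j. B \<in> set S \<Longrightarrow> i \<in> B \<Longrightarrow> j \<in> B \<Longrightarrow> x $ i = x $ j"
      and down: "\<And>k i j. Suc k < length S \<Longrightarrow> i \<in> S ! k \<Longrightarrow> j \<in> S ! Suc k \<Longrightarrow> x $ j \<le> x $ i"
      and wrap: "\<And>i j. S \<noteq> [] \<Longrightarrow> i \<in> last S \<Longrightarrow> j \<in> hd S \<Longrightarrow> x $ j - 1 \<le> x $ i"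
      using x unfolding alcoved_simplex_def by blast+
    have mono: "x $ j \<le> x $ i" if "k \<le> l" "l < length S" "i \<in> S ! k" "j \<in> S ! l" for k l i j
      using that
    proof (induction l arbitrary: j rule: dec_induct)
      case base
      then show ?case using eq[of "S ! k" i j] by simp
    next
      case (step l)
      \<comment> \<open>Nonempty blocks let the inequalities between neighbouring blocks
        chain.\<close>
      obtain j' where "j' \<in> S ! l" using nonempty[of l] step.prems by auto
      then show ?case
        using step.IH[of j'] step.prems down[of l j' j] by simp
    qed
    have "x $ i - x $ j \<le> cost r i j" if "i \<in> \<Union> (set S)" "j \<in> \<Union> (set S)" for i j
    proof -
      obtain k l where k: "k < length S" "i \<in> S ! k" and l: "l < length S" "j \<in> S ! l"
        using \<open>i \<in> _\<close> \<open>j \<in> _\<close> by (metis UnionE in_set_conv_nth)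
      show ?thesis
      proof (cases "r i < r j")
        case True
        have S: "S \<noteq> []" using k by auto
        obtain f g where f: "f \<in> S ! 0" and g: "g \<in> S ! (length S - 1)"
          using nonempty[of 0] nonempty[of "length S - 1"] S by auto
        \<comment> \<open>The chain runs from \<open>i\<close> to the first block, by the
          wrap-around inequality to the last block, and on to \<open>j\<close>; only the wrap costs
          1.\<close>
        have "x $ i \<le> x $ f" using mono[of 0 k f i] f k by simp
        moreover have "x $ g \<le> x $ j" using mono[of l "length S - 1" j g] g l by simp
        moreover have "x $ f - 1 \<le> x $ g"
          using wrap[OF S, of g f] f g S by (simp add: last_conv_nth hd_conv_nth)
        ultimately show ?thesis using True by (simp add: cost_def)
      next
        case False
        then have "l \<le> k" using less[of k l i j] k l by force
        then have "x $ i \<le> x $ j" using mono[of l k j i] k l by simp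
        then show ?thesis by (simp add: cost_def)
      qed
    qed
    moreover have "x \<in> zero_sum_space (\<Union> (set S))"
      using x unfolding alcoved_simplex_def by blast
    ultimately show "x \<in> diff_polytope (\<Union> (set S)) (cost r)"
      unfolding diff_polytope_def by blast
  next
    assume x: "x \<in> diff_polytope (\<Union> (set S)) (cost r)"
    have le: "x $ i - x $ j \<le> cost r i j" if "B \<in> set S" "C \<in> set S" "i \<in> B" "j \<in> C" for B C i j
      using x that by (auto simp: diff_polytope_def)
    have "x $ i = x $ j" if "B \<in> set S" "i \<in> B" "j \<in> B" for B i j
      using le[of B B i j] le[of B B j i] const[of B i j] that by (simp add: cost_def)
    moreover have "x $ j \<le> x $ i" if "Suc k < length S" "i \<in> S ! k" "j \<in> S ! Suc k" for k i j
      using le[of "S ! Suc k" "S ! k" j i] less[of k "Suc k" i j] that by (simp add: cost_def)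
    moreover have "x $ j - 1 \<le> x $ i" if "S \<noteq> []" "i \<in> last S" "j \<in> hd S" for i j
      using le[of "hd S" "last S" j i] that by (auto simp: cost_def split: if_splits)
    ultimately show "x \<in> alcoved_simplex S"
      using x unfolding alcoved_simplex_def diff_polytope_def by blast
  }
qed

theorem theoremB:
  fixes S T :: "'n::finite set list"
  assumes "ordered_set_partition UNIV S"
    and "ordered_set_partition UNIV T"
  shows "compatible UNIV (alcoved_simplex S) (alcoved_simplex T) \<longleftrightarrow>
    (\<forall>I :: 'n set. card I \<le> 6 \<longrightarrow>
      compatible I (alcoved_simplex (restrict_osp S I)) (alcoved_simplex (restrict_osp T I)))"
proof -
  obtain r s where r: "ranked r S" and s: "ranked s T"
    using assms ranked_exists by blast
  have UN: "\<Union> (set S) = UNIV" "\<Union> (set T) = UNIV"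
    using assms by (auto simp: ordered_set_partition_def partition_on_def)
  have "compatible UNIV (alcoved_simplex S) (alcoved_simplex T) \<longleftrightarrow> splits UNIV r s"
    using alcoved_simplex_eq_diff_polytope[OF r] alcoved_simplex_eq_diff_polytope[OF s] UN
    by (simp add: compatible_iff_splits)
  moreover have "compatible I (alcoved_simplex (restrict_osp S I)) (alcoved_simplex (restrict_osp T I))
      \<longleftrightarrow> splits I r s" for I
    using alcoved_simplex_eq_diff_polytope[OF ranked_restrict[OF r]]
      alcoved_simplex_eq_diff_polytope[OF ranked_restrict[OF s]] UN
    by (simp add: compatible_iff_splits Union_restrict_osp)
  ultimately show ?thesis
    by (simp add: splits_local)
qed

end
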